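(* Let $n\ge1$, let $a(z)=1+a_1z+\cdots+a_nz^n$ and $c(z)=1+c_1z+\cdots+c_nz^n$ be real polynomials, and let $F,G,M(c,a),N(c)$ be the $2n\times2n$ matrices defined in the context. The following identities hold: $$M(c,a)\,F\,M(c,a)^{-1}=\begin{pmatrix}P(J-ea^\top)P&0\\ (c-a)e^\top&PJP-ce^\top\end{pmatrix}=:F_M$$ and $$N(c)\,G\,N(c)^{-1}=\begin{pmatrix}P(J-ea^\top)P&0\\ e e^\top&J-ec^\top\end{pmatrix}=:G_N.$$ Moreover, $$F_M\begin{pmatrix}I&0\\0&B(c,a)\end{pmatrix}=\begin{pmatrix}I&0\\0&B(c,a)\end{pmatrix}G_N.$$
   Context: The letters $a,c$ also denote the column vectors $a=(a_1,\dots,a_n)^\top$, $c=(c_1,\dots,c_n)^\top$; $a_0=c_0=1$. $e=e_n$ is the first standard basis vector of $\mathbb{R}^n$ and $e_{2n}$ that of $\mathbb{R}^{2n}$; $J$ denotes the shift matrix of the appropriate size ($J_{ij}=1$ if $i=j+1$ and $0$ otherwise); $P$ is the $n\times n$ anti-diagonal identity, $P_{ij}=\delta_{i,n+1-j}$; $I$ is the $n\times n$ identity. Let $a(z)c(z)=1+\sum_{k=1}^{2n}g_kz^k$ and $g=(g_1,\dots,g_{2n})^\top$. Define $$F=\begin{pmatrix}J-ea^\top&0\\0&J-ec^\top\end{pmatrix},\qquad G=J-e_{2n}g^\top\quad(2n\times2n).$$ $S(c)$ is the $n\times n$ Hankel matrix with $S(c)_{ij}=c_{i+j-1}$ if $i+j\le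 n+1$ and $0$ otherwise. $S(\hat c)$ is the $n\times n$ Hankel matrix with $S(\hat c)_{ij}=c_{n+1-i-j}$ if $i+j\le n+1$ and $0$ otherwise (first row $(c_{n-1},\dots,c_1,1)$), and $S(\hat a)$ is defined likewise from $a$. Define $$M(c,a)=\begin{pmatrix}P&0\\ P S(\hat a)P&P S(\hat c)P\end{pmatrix},\qquad N(c)=\begin{pmatrix}P S(\hat c)P&S(c)\\0&I\end{pmatrix};$$ both are invertible. With $u_n(z)=(1,z,\dots,z^{n-1})^\top$, the Bezout matrix $B(c,a)$ is the $n\times n$ matrix defined by $c(z)a(w)-c(w)a(z)=(z-w)\,u_n(z)^\top B(c,a)u_n(w)$. *)

theory Defs
  imports
    "HOL-Computational_Algebra.Polynomial"
    "Jordan_Normal_Form.Determinant"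
    "Jordan_Normal_Form.Gauss_Jordan_Elimination"
begin

(* Matrices and vectors are those of Jordan_Normal_Form, hence indexed from 0; the entry
   in position (i, j) below is the one in row i + 1 and column j + 1 of the usual
   1-based description.  The polynomial 1 + a_1 z + ... + a_n z^n is an element of
   real poly with constant coefficient 1 and degree at most n, so the vector
   (a_1, ..., a_n) depends on n and not only on the polynomial. *)

definition shift_mat :: "nat \<Rightarrow> real mat" where
  "shift_mat m = mat m m (\<lambda>(i, j). if i = Suc j then 1 else 0)"

definition flip_mat :: "nat \<Rightarrow> real mat" where
  "flip_mat n = mat n n (\<lambda>(i, j). if i + j + 1 = n then 1 else 0)"

definition outer_prod :: "real vec \<Rightarrow> real vec \<Rightarrow> real mat" where
  "outer_prod u v = mat (dim_vec u) (dim_vec v) (\<lambda>(i, j). u $ i * v $ j)"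

definition first_unit :: "nat \<Rightarrow> real vec" where
  "first_unit m = unit_vec m 0"

(* The column vector (p_1, ..., p_m): the constant coefficient p_0 is left out. *)
definition coeff_vec :: "nat \<Rightarrow> real poly \<Rightarrow> real vec" where
  "coeff_vec m p = vec m (\<lambda>i. coeff p (i + 1))"

(* J - e p^T *)
definition companion_mat :: "nat \<Rightarrow> real poly \<Rightarrow> real mat" where
  "companion_mat m p = shift_mat m - outer_prod (first_unit m) (coeff_vec m p)"

definition F_mat :: "nat \<Rightarrow> real poly \<Rightarrow> real poly \<Rightarrow> real mat" where
  "F_mat n a c =
     four_block_mat (companion_mat n a) (0\<^sub>m n n)
                    (0\<^sub>m n n) (companion_mat n c)"

(* g is the vector of the coefficients of a(z) c(z) at z, ..., z^(2n). *)
definition G_mat :: "nat \<Rightarrow> real poly \<Rightarrow> real poly \<Rightarrow> real mat" where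
  "G_mat n a c = companion_mat (2 * n) (a * c)"

(* S(c): entry c_(i+j-1) for i + j <= n + 1 in 1-based indices. *)
definition hankel_mat :: "nat \<Rightarrow> real poly \<Rightarrow> real mat" where
  "hankel_mat n p = mat n n (\<lambda>(i, j). if i + j < n then coeff p (i + j + 1) else 0)"

(* S(c^): entry c_(n+1-i-j) for i + j <= n + 1 in 1-based indices. *)
definition hankel_hat_mat :: "nat \<Rightarrow> real poly \<Rightarrow> real mat" where
  "hankel_hat_mat n p = mat n n (\<lambda>(i, j). if i + j < n then coeff p (n - 1 - i - j) else 0)"

definition M_mat :: "nat \<Rightarrow> real poly \<Rightarrow> real poly \<Rightarrow> real mat" where
  "M_mat n c a =
     four_block_mat (flip_mat n) (0\<^sub>m n n)
                    (flip_mat n * hankel_hat_mat n a * flip_mat n)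
                    (flip_mat n * hankel_hat_mat n c * flip_mat n)"

definition N_mat :: "nat \<Rightarrow> real poly \<Rightarrow> real mat" where
  "N_mat n c =
     four_block_mat (flip_mat n * hankel_hat_mat n c * flip_mat n) (hankel_mat n c)
                    (0\<^sub>m n n) (1\<^sub>m n)"

definition FM_mat :: "nat \<Rightarrow> real poly \<Rightarrow> real poly \<Rightarrow> real mat" where
  "FM_mat n a c =
     four_block_mat
       (flip_mat n * companion_mat n a * flip_mat n)
       (0\<^sub>m n n)
       (outer_prod (coeff_vec n c - coeff_vec n a) (first_unit n))
       (flip_mat n * shift_mat n * flip_mat n - outer_prod (coeff_vec n c) (first_unit n))"

definition GN_mat :: "nat \<Rightarrow> real poly \<Rightarrow> real poly \<Rightarrow> real mat" where
  "GN_mat n a c =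
     four_block_mat
       (flip_mat n * companion_mat n a * flip_mat n)
       (0\<^sub>m n n)
       (outer_prod (first_unit n) (first_unit n))
       (companion_mat n c)"

definition power_vec :: "nat \<Rightarrow> real \<Rightarrow> real vec" where
  "power_vec n z = vec n (\<lambda>i. z ^ i)"

definition is_bezout_mat :: "nat \<Rightarrow> real poly \<Rightarrow> real poly \<Rightarrow> real mat \<Rightarrow> bool" where
  "is_bezout_mat n c a B \<longleftrightarrow>
     B \<in> carrier_mat n n \<and>
     (\<forall>z w. poly c z * poly a w - poly c w * poly a z
            = (z - w) * (power_vec n z \<bullet> (B *\<^sub>v power_vec n w)))"

(* The description is justified by bezout_mat_unique_exists below. *)
definition bezout_mat :: "nat \<Rightarrow> real poly \<Rightarrow> real poly \<Rightarrow> real mat" where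
  "bezout_mat n c a = (THE B. is_bezout_mat n c a B)"


section \<open>The Bezout matrix is well defined\<close>

lemma bezout_form:
  assumes "B \<in> carrier_mat n n"
  shows "power_vec n z \<bullet> (B *\<^sub>v power_vec n w)
         = (\<Sum>i<n. \<Sum>j<n. B $$ (i, j) * z ^ i * w ^ j)"
  using assms
  by (auto simp: power_vec_def scalar_prod_def atLeast0LessThan sum_distrib_left
      intro!: sum.cong)

lemma power_sum_zero_coeffs:
  fixes f :: "nat \<Rightarrow> real"
  assumes "infinite {z. (\<Sum>i<n. f i * z ^ i) = 0}" and "i < n"
  shows "f i = 0"
proof -
  define p where "p = (\<Sum>i<n. monom (f i) i)"
  have "poly p z = (\<Sum>i<n. f i * z ^ i)" for z
    by (simp add: p_def poly_sum poly_monom)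
  with assms(1) have "infinite {z. poly p z = 0}" by simp
  then have "p = 0" using poly_roots_finite by blast
  moreover have "coeff p i = f i"
    using assms(2) by (simp add: p_def coeff_sum)
  ultimately show ?thesis by simp
qed

lemma bezout_unique:
  assumes B: "is_bezout_mat n c a B" and C: "is_bezout_mat n c a C"
  shows "B = C"
proof -
  have cB: "B \<in> carrier_mat n n" and cC: "C \<in> carrier_mat n n"
    using B C by (auto simp: is_bezout_mat_def)
  define D where "D i j = B $$ (i, j) - C $$ (i, j)" for i j
  have form: "(\<Sum>i<n. (\<Sum>j<n. D i j * w ^ j) * z ^ i) = 0" if "z \<noteq> w" for z w
  proof -
    have "(z - w) * (power_vec n z \<bullet> (B *\<^sub>v power_vec n w))
          = (z - w) * (power_vec n z \<bullet> (C *\<^sub>v power_vec n w))"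
      using B C unfolding is_bezout_mat_def by metis
    then have "power_vec n z \<bullet> (B *\<^sub>v power_vec n w)
               = power_vec n z \<bullet> (C *\<^sub>v power_vec n w)"
      using that by simp
    then have "(\<Sum>i<n. \<Sum>j<n. B $$ (i, j) * z ^ i * w ^ j)
               - (\<Sum>i<n. \<Sum>j<n. C $$ (i, j) * z ^ i * w ^ j) = 0"
      by (simp add: bezout_form[OF cB] bezout_form[OF cC])
    then show ?thesis
      by (simp add: D_def sum_subtractf sum_distrib_left sum_distrib_right algebra_simps)
  qed
  have row: "(\<Sum>j<n. D i j * w ^ j) = 0" if "i < n" for i w
  proof (rule power_sum_zero_coeffs[OF _ that])
    have "infinite (UNIV - {w})" by (simp add: infinite_UNIV_char_0)
    moreover have "UNIV - {w} \<subseteq> {z. (\<Sum>i<n. (\<Sum>j<n. D i j * w ^ j) * z ^ i) = 0}"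
      using form by auto
    ultimately show "infinite {z. (\<Sum>i<n. (\<Sum>j<n. D i j * w ^ j) * z ^ i) = 0}"
      using infinite_super by blast
  qed
  have "D i j = 0" if "i < n" "j < n" for i j
    using row[OF that(1)]
    by (intro power_sum_zero_coeffs[OF _ that(2)]) (simp add: infinite_UNIV_char_0)
  then show ?thesis
    using cB cC by (intro eq_matI) (auto simp: D_def)
qed

lemma bezout_exists:
  assumes dega: "degree a \<le> n" and degc: "degree c \<le> n"
  shows "\<exists>B. is_bezout_mat n c a B"
proof -
  define q where "q i j = coeff c i * coeff a j - coeff c j * coeff a i" for i j
  define b where "b i j = (\<Sum>k\<le>j. q (i + 1 + k) (j - k))" for i j
  define B where "B = mat n n (\<lambda>(i, j). b i j)"
  have q_big: "q i j = 0" if "i > n \<or> j > n" for i j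
    using that dega degc by (auto simp: q_def coeff_eq_0)
  have antisym: "(\<Sum>k\<le>s. q k (s - k)) = 0" for s
  proof -
    have "(\<Sum>k\<le>s. q k (s - k)) = (\<Sum>k\<le>s. q (s - k) (s - (s - k)))"
      by (rule sum.reindex_bij_witness[of _ "\<lambda>k. s - k" "\<lambda>k. s - k"]) auto
    also have "\<dots> = (\<Sum>k\<le>s. - q k (s - k))"
      by (intro sum.cong) (auto simp: q_def)
    finally show ?thesis by (simp add: sum_negf)
  qed
  have split_sum: "(\<Sum>k\<le>i + 1 + j. q k (i + 1 + j - k))
                   = (\<Sum>k\<le>i. q k (i + 1 + j - k)) + b i j" for i j
  proof -
    have "{..i + 1 + j} = {..i} \<union> {i + 1..i + 1 + j}" by auto
    then have "(\<Sum>k\<le>i + 1 + j. q k (i + 1 + j - k))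
          = (\<Sum>k\<le>i. q k (i + 1 + j - k)) + (\<Sum>k=i+1..i+1+j. q k (i + 1 + j - k))"
      by (simp only:) (rule sum.union_disjoint, auto)
    also have "(\<Sum>k=i+1..i+1+j. q k (i + 1 + j - k)) = b i j"
      unfolding b_def
      by (rule sum.reindex_bij_witness[of _ "\<lambda>k. i + 1 + k" "\<lambda>k. k - (i + 1)"]) (auto simp: add.commute)
    finally show ?thesis .
  qed
  have b_n: "b i n = 0" for i
  proof -
    have "(\<Sum>k\<le>i. q k (i + 1 + n - k)) = 0"
      by (intro sum.neutral ballI q_big) auto
    then show ?thesis using split_sum[of i n] antisym[of "i + 1 + n"] by simp
  qed
  have b_big: "b n j = 0" for j
    using q_big by (auto simp: b_def intro!: sum.neutral)
  have b_0: "b 0 j = - q 0 (Suc j)" for j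
    using split_sum[of 0 j] antisym[of "Suc j"] by simp
  have b_i0: "b i 0 = q (Suc i) 0" for i by (simp add: b_def)
  have b_rec: "b i (Suc j) = q (Suc i) (Suc j) + b (Suc i) j" for i j
    unfolding b_def by (subst sum.atMost_Suc_shift) simp
  have pc: "poly c z = (\<Sum>i\<le>n. coeff c i * z ^ i)" for z
    using degc by (subst poly_altdef) (rule sum.mono_neutral_left, auto simp: coeff_eq_0)
  have pa: "poly a z = (\<Sum>i\<le>n. coeff a i * z ^ i)" for z
    using dega by (subst poly_altdef) (rule sum.mono_neutral_left, auto simp: coeff_eq_0)
  have "poly c z * poly a w - poly c w * poly a z
        = (z - w) * (power_vec n z \<bullet> (B *\<^sub>v power_vec n w))" for z w
  proof -
    define L where "L i j = (if i = 0 then 0 else b (i - 1) j) * (z ^ i * w ^ j)" for i j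
    define R where "R i j = (if j = 0 then 0 else b i (j - 1)) * (z ^ i * w ^ j)" for i j
    have q_LR: "q i j * (z ^ i * w ^ j) = L i j - R i j" for i j
    proof (cases i)
      case 0
      then show ?thesis
        by (cases j) (simp_all add: L_def R_def b_0 q_def algebra_simps)
    next
      case (Suc i')
      then show ?thesis
        by (cases j) (simp_all add: L_def R_def b_i0 b_rec algebra_simps)
    qed
    have cw: "poly c w * poly a z
              = (\<Sum>i\<le>n. \<Sum>j\<le>n. (coeff a i * z ^ i) * (coeff c j * w ^ j))"
      by (subst mult.commute) (simp only: pc pa sum_product)
    have cz: "poly c z * poly a w
              = (\<Sum>i\<le>n. \<Sum>j\<le>n. (coeff c i * z ^ i) * (coeff a j * w ^ j))"
      by (simp add: pc pa sum_product)
    have "poly c z * poly a w - poly c w * poly a z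
          = (\<Sum>i\<le>n. \<Sum>j\<le>n. q i j * (z ^ i * w ^ j))"
      unfolding cz cw sum_subtractf[symmetric]
      by (intro sum.cong refl) (simp add: q_def algebra_simps)
    also have "\<dots> = (\<Sum>i\<le>n. \<Sum>j\<le>n. L i j) - (\<Sum>i\<le>n. \<Sum>j\<le>n. R i j)"
      by (simp add: q_LR sum_subtractf)
    also have "(\<Sum>i\<le>n. \<Sum>j\<le>n. L i j) = (\<Sum>i<n. \<Sum>j<n. b i j * (z ^ Suc i * w ^ j))"
    proof -
      have "(\<Sum>i\<le>n. \<Sum>j\<le>n. L i j) = (\<Sum>i<n. \<Sum>j\<le>n. L (Suc i) j)"
        by (subst sum.atMost_shift) (simp add: L_def)
      also have "\<dots> = (\<Sum>i<n. \<Sum>j<n. L (Suc i) j)"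
        by (simp add: lessThan_Suc_atMost[symmetric] L_def b_n)
      finally show ?thesis by (simp add: L_def)
    qed
    also have "(\<Sum>i\<le>n. \<Sum>j\<le>n. R i j) = (\<Sum>i<n. \<Sum>j<n. b i j * (z ^ i * w ^ Suc j))"
    proof -
      have "(\<Sum>i\<le>n. \<Sum>j\<le>n. R i j) = (\<Sum>i\<le>n. \<Sum>j<n. R i (Suc j))"
        by (simp only: sum.atMost_shift[of "R _"]) (simp add: R_def)
      also have "\<dots> = (\<Sum>i<n. \<Sum>j<n. R i (Suc j))"
        by (simp add: lessThan_Suc_atMost[symmetric] R_def b_big)
      finally show ?thesis by (simp add: R_def)
    qed
    also have "(\<Sum>i<n. \<Sum>j<n. b i j * (z ^ Suc i * w ^ j))
               - (\<Sum>i<n. \<Sum>j<n. b i j * (z ^ i * w ^ Suc j))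
               = (z - w) * (\<Sum>i<n. \<Sum>j<n. b i j * z ^ i * w ^ j)"
      by (simp add: sum_distrib_left sum_subtractf[symmetric] algebra_simps)
    also have "(\<Sum>i<n. \<Sum>j<n. b i j * z ^ i * w ^ j)
               = power_vec n z \<bullet> (B *\<^sub>v power_vec n w)"
      by (subst bezout_form) (auto simp: B_def)
    finally show ?thesis .
  qed
  then have "is_bezout_mat n c a B" by (auto simp: is_bezout_mat_def B_def)
  then show ?thesis ..
qed

lemma bezout_mat_unique_exists:
  assumes "degree a \<le> n" "degree c \<le> n"
  shows "\<exists>!B. is_bezout_mat n c a B"
  using bezout_exists[OF assms] bezout_unique by blast

lemma is_bezout_mat_bezout_mat:
  assumes "degree a \<le> n" "degree c \<le> n"
  shows "is_bezout_mat n c a (bezout_mat n c a)"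
  unfolding bezout_mat_def by (rule theI'[OF bezout_mat_unique_exists[OF assms]])


section \<open>M(c, a) and N(c) are invertible\<close>

lemma mat_inverse_some:
  fixes A :: "real mat"
  assumes A: "A \<in> carrier_mat m m" and det: "det A \<noteq> 0"
  shows "\<exists>B \<in> carrier_mat m m. mat_inverse A = Some B \<and> A * B = 1\<^sub>m m \<and> B * A = 1\<^sub>m m"
proof (cases "mat_inverse A")
  case None
  then show ?thesis
    using mat_inverse(1)[OF A None, of "()"] det_non_zero_imp_unit[OF A det, of "()"] by blast
next
  case (Some B)
  then show ?thesis using mat_inverse(2)[OF A Some] by blast
qed

lemma det_flip_mat: "det (flip_mat n) \<noteq> 0"
proof -
  have "flip_mat n * flip_mat n = 1\<^sub>m n"
  proof (rule eq_matI)
    fix i j assume "i < dim_row (1\<^sub>m n :: real mat)" "j < dim_col (1\<^sub>m n :: real mat)"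
    then have ij: "i < n" "j < n" by auto
    then have "(flip_mat n * flip_mat n) $$ (i, j)
               = (\<Sum>k\<in>{0..<n}. (if i + k + 1 = n then 1 else 0) * (if k + j + 1 = n then 1 else 0))"
      by (simp add: flip_mat_def scalar_prod_def)
    also have "\<dots> = (\<Sum>k\<in>{0..<n}. if k = n - 1 - i then (if k + j + 1 = n then 1 else 0) else 0)"
      using ij by (intro sum.cong refl) auto
    also have "\<dots> = 1\<^sub>m n $$ (i, j)"
      using ij by (subst sum.delta) auto
    finally show "(flip_mat n * flip_mat n) $$ (i, j) = 1\<^sub>m n $$ (i, j)" .
  qed (auto simp: flip_mat_def)
  moreover have "flip_mat n \<in> carrier_mat n n" by (simp add: flip_mat_def)
  ultimately have "det (flip_mat n) * det (flip_mat n) = 1"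
    by (metis det_mult det_one)
  then show ?thesis by auto
qed

lemma det_flip_hankel_hat:
  assumes "coeff p 0 = 1"
  shows "det (flip_mat n * hankel_hat_mat n p * flip_mat n) \<noteq> 0"
proof -
  have P: "flip_mat n \<in> carrier_mat n n" and H: "hankel_hat_mat n p \<in> carrier_mat n n"
    by (auto simp: flip_mat_def hankel_hat_mat_def)
  define T where "T = hankel_hat_mat n p * flip_mat n"
  have T: "T \<in> carrier_mat n n" unfolding T_def using P H by auto
  have ent: "T $$ (i, j) = (if i \<le> j then coeff p (j - i) else 0)" if ij: "i < n" "j < n" for i j
  proof -
    have "T $$ (i, j) = (\<Sum>k\<in>{0..<n}. (if i + k < n then coeff p (n - 1 - i - k) else 0)
                           * (if k + j + 1 = n then 1 else 0))"
      using ij by (simp add: T_def flip_mat_def hankel_hat_mat_def scalar_prod_def)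
    also have "\<dots> = (\<Sum>k\<in>{0..<n}. if k = n - 1 - j
                           then (if i + k < n then coeff p (n - 1 - i - k) else 0) else 0)"
      using ij by (intro sum.cong refl) auto
    also have "\<dots> = (if i \<le> j then coeff p (j - i) else 0)"
      using ij by (subst sum.delta) (auto intro!: arg_cong[of _ _ "coeff p"])
    finally show ?thesis .
  qed
  have "upper_triangular T" using T ent by (auto intro!: upper_triangularI)
  then have "det T = prod_list (diag_mat T)" using T by (rule det_upper_triangular)
  also have "diag_mat T = map (\<lambda>i. 1) [0..<n]"
    using T ent assms by (auto simp: diag_mat_def)
  also have "prod_list \<dots> = (1 :: real)"
    by (simp add: map_replicate_const)
  finally have "det T = 1" .
  moreover have "flip_mat n * hankel_hat_mat n p * flip_mat n = flip_mat n * T"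
    unfolding T_def using P H by (intro assoc_mult_mat) auto
  ultimately show ?thesis
    using det_mult[OF P T] det_flip_mat[of n] by simp
qed

lemma M_mat_carrier: "M_mat n c a \<in> carrier_mat (2 * n) (2 * n)"
  by (auto simp: M_mat_def flip_mat_def hankel_hat_mat_def mult_2)

lemma N_mat_carrier: "N_mat n c \<in> carrier_mat (2 * n) (2 * n)"
  by (auto simp: N_mat_def flip_mat_def hankel_mat_def mult_2)

lemma M_mat_inverse:
  assumes "coeff c 0 = 1"
  shows "\<exists>B \<in> carrier_mat (2 * n) (2 * n). mat_inverse (M_mat n c a) = Some B \<and>
           M_mat n c a * B = 1\<^sub>m (2 * n) \<and> B * M_mat n c a = 1\<^sub>m (2 * n)"
proof (rule mat_inverse_some[OF M_mat_carrier])
  have "det (M_mat n c a)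
        = det (flip_mat n) * det (flip_mat n * hankel_hat_mat n c * flip_mat n)"
    unfolding M_mat_def
    by (rule det_four_block_mat_upper_right_zero) (auto simp: flip_mat_def hankel_hat_mat_def)
  then show "det (M_mat n c a) \<noteq> 0"
    using det_flip_mat det_flip_hankel_hat[OF assms] by simp
qed

lemma N_mat_inverse:
  assumes "coeff c 0 = 1"
  shows "\<exists>B \<in> carrier_mat (2 * n) (2 * n). mat_inverse (N_mat n c) = Some B \<and>
           N_mat n c * B = 1\<^sub>m (2 * n) \<and> B * N_mat n c = 1\<^sub>m (2 * n)"
proof (rule mat_inverse_some[OF N_mat_carrier])
  have "det (N_mat n c)
        = det (flip_mat n * hankel_hat_mat n c * flip_mat n) * det (1\<^sub>m n :: real mat)"
    unfolding N_mat_def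
    by (rule det_four_block_mat_lower_left_zero)
      (auto simp: flip_mat_def hankel_hat_mat_def hankel_mat_def)
  then show "det (N_mat n c) \<noteq> 0"
    using det_flip_hankel_hat[OF assms] by simp
qed

end

theory Submission
  imports Defs
begin

text \<open>
  The two similarities are equivalent to \<open>M F = F\<^sub>M M\<close> and \<open>N G = G\<^sub>N N\<close>, which are
  compared block by block: multiplication by a companion matrix shifts a Hankel matrix along its
  antidiagonals and changes only one row or column, and in \<open>N G = G\<^sub>N N\<close> this exceptional
  row is the convolution formula for the coefficients of \<open>a c\<close>.  The last identity is the
  recursion \<open>b\<^bsub>i,j+1\<^esub> - b\<^bsub>i+1,j\<^esub> = c\<^bsub>i+1\<^esub> a\<^bsub>j+1\<^esub> - c\<^bsub>j+1\<^esub> a\<^bsub>i+1\<^esub>\<close> for the entries of the Bezout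
  matrix (indexed from 0), with first row and first column \<open>c - a\<close>, obtained by comparing coefficients in its
  defining equation.
\<close>

section \<open>Dimensions and entries of the structured matrices\<close>

lemma flip_mat_carrier [simp]: "flip_mat n \<in> carrier_mat n n"
  by (simp add: flip_mat_def)

lemma shift_mat_carrier [simp]: "shift_mat n \<in> carrier_mat n n"
  by (simp add: shift_mat_def)

lemma hankel_mat_carrier [simp]: "hankel_mat n p \<in> carrier_mat n n"
  by (simp add: hankel_mat_def)

lemma hankel_hat_mat_carrier [simp]: "hankel_hat_mat n p \<in> carrier_mat n n"
  by (simp add: hankel_hat_mat_def)

lemma companion_mat_carrier [simp]: "companion_mat n p \<in> carrier_mat n n"
  unfolding companion_mat_def outer_prod_def first_unit_def coeff_vec_def
  by (intro minus_carrier_mat) simp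

lemma outer_prod_carrier:
  "dim_vec u = m \<Longrightarrow> dim_vec v = n \<Longrightarrow> outer_prod u v \<in> carrier_mat m n"
  by (simp add: outer_prod_def)

lemma dim_outer_prod [simp]:
  "dim_row (outer_prod u v) = dim_vec u" "dim_col (outer_prod u v) = dim_vec v"
  by (simp_all add: outer_prod_def)

lemmas dim_structured_mats [simp] =
  flip_mat_carrier[THEN carrier_matD(1)] flip_mat_carrier[THEN carrier_matD(2)]
  shift_mat_carrier[THEN carrier_matD(1)] shift_mat_carrier[THEN carrier_matD(2)]
  hankel_mat_carrier[THEN carrier_matD(1)] hankel_mat_carrier[THEN carrier_matD(2)]
  hankel_hat_mat_carrier[THEN carrier_matD(1)] hankel_hat_mat_carrier[THEN carrier_matD(2)]
  companion_mat_carrier[THEN carrier_matD(1)] companion_mat_carrier[THEN carrier_matD(2)]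

lemma dim_first_unit [simp]: "dim_vec (first_unit n) = n"
  by (simp add: first_unit_def)

lemma dim_coeff_vec [simp]: "dim_vec (coeff_vec n p) = n"
  by (simp add: coeff_vec_def)

lemma index_outer_prod:
  "i < dim_vec u \<Longrightarrow> j < dim_vec v \<Longrightarrow> outer_prod u v $$ (i, j) = u $ i * v $ j"
  by (simp add: outer_prod_def)

lemma index_first_unit: "i < n \<Longrightarrow> first_unit n $ i = (if i = 0 then 1 else 0)"
  by (simp add: first_unit_def)

lemma index_coeff_vec: "i < n \<Longrightarrow> coeff_vec n p $ i = coeff p (Suc i)"
  by (simp add: coeff_vec_def)

lemma index_hankel_mat:
  "i < n \<Longrightarrow> j < n \<Longrightarrow>
     hankel_mat n p $$ (i, j) = (if i + j < n then coeff p (Suc (i + j)) else 0)"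
  by (simp add: hankel_mat_def)

lemma index_companion_mat:
  "i < n \<Longrightarrow> j < n \<Longrightarrow> companion_mat n p $$ (i, j) =
     (if i = Suc j then 1 else 0) - (if i = 0 then coeff p (Suc j) else 0)"
  by (simp add: companion_mat_def shift_mat_def outer_prod_def first_unit_def coeff_vec_def)

section \<open>Entries of products with flip, shift and companion matrices\<close>

lemma index_mult_mat_sum:
  assumes "A \<in> carrier_mat m n" "B \<in> carrier_mat n l" "i < m" "j < l"
  shows "(A * B) $$ (i, j) = (\<Sum>k<n. A $$ (i, k) * B $$ (k, j))"
  using assms by (auto simp: scalar_prod_def atLeast0LessThan)

text \<open>Entries of products are evaluated by the explicit formulas below rather than as scalar
  products of a row and a column.\<close>

declare index_mult_mat(1) [simp del]

lemma index_mult_flip_mat: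
  assumes "A \<in> carrier_mat n n" "i < n" "j < n"
  shows "(A * flip_mat n) $$ (i, j) = A $$ (i, n - 1 - j)"
proof -
  \<comment> \<open>The two sums are compared term by term, so \<open>sum.delta\<close> and its
    relatives stay disabled until the sum has this form. The same device serves for the products
    below.\<close>
  have "(A * flip_mat n) $$ (i, j) = (\<Sum>k<n. if k = n - 1 - j then A $$ (i, k) else 0)"
    using assms by (subst index_mult_mat_sum[of _ n n])
      (auto simp: flip_mat_def
        simp del: sum.delta sum.delta' sum.lessThan_Suc intro!: sum.cong)
  then show ?thesis using assms by simp
qed

lemma index_flip_mat_mult:
  assumes "A \<in> carrier_mat n n" "i < n" "j < n"
  shows "(flip_mat n * A) $$ (i, j) = A $$ (n - 1 - i, j)"
proof -
  have "(flip_mat n * A) $$ (i, j) = (\<Sum>k<n. if k = n - 1 - i then A $$ (k, j) else 0)"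
    using assms by (subst index_mult_mat_sum[of _ n n])
      (auto simp: flip_mat_def
        simp del: sum.delta sum.delta' sum.lessThan_Suc intro!: sum.cong)
  then show ?thesis using assms by simp
qed

text \<open>The two flips reverse rows and columns, so conjugation by P is a half turn of the
  matrix.\<close>

lemma index_flip_mat_conj:
  assumes "A \<in> carrier_mat n n" "i < n" "j < n"
  shows "(flip_mat n * A * flip_mat n) $$ (i, j) = A $$ (n - 1 - i, n - 1 - j)"
  using assms
  by (simp add: index_mult_flip_mat index_flip_mat_mult mult_carrier_mat[of _ n n])

lemma flip_mat_square: "flip_mat n * flip_mat n = 1\<^sub>m n"
proof (rule eq_matI)
  fix i j assume "i < dim_row (1\<^sub>m n :: real mat)" "j < dim_col (1\<^sub>m n :: real mat)"
  then show "(flip_mat n * flip_mat n) $$ (i, j) = 1\<^sub>m n $$ (i, j)"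
    by (subst index_mult_flip_mat) (auto simp: flip_mat_def)
qed (auto simp: flip_mat_def)

text \<open>The half turn moves the nonzero triangle to the lower right, with the constant
  coefficient on the antidiagonal. When that coefficient is 1, the first row and the first column
  are the last unit vector.\<close>

lemma index_flip_hankel_hat:
  assumes "i < n" "j < n"
  shows "(flip_mat n * hankel_hat_mat n p * flip_mat n) $$ (i, j) =
           (if n \<le> Suc (i + j) then coeff p (Suc (i + j) - n) else 0)"
proof -
  \<comment> \<open>Both sides truncate to 0 in the same cases, so no case distinction is
    made.\<close>
  have "n - 1 - (n - 1 - i) - (n - 1 - j) = Suc (i + j) - n"
    using assms by linarith
  then show ?thesis
    using assms by (subst index_flip_mat_conj) (auto simp: hankel_hat_mat_def)
qed

text \<open>J on the right moves the columns one place to the left and empties the last one; the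
  rank-one part sees only column 0 of \<open>A\<close>.\<close>

lemma index_mult_companion_mat:
  assumes "A \<in> carrier_mat n n" "i < n" "j < n"
  shows "(A * companion_mat n p) $$ (i, j) =
           (if Suc j < n then A $$ (i, Suc j) else 0) - A $$ (i, 0) * coeff p (Suc j)"
proof -
  have "(A * companion_mat n p) $$ (i, j) =
      (\<Sum>k<n. (if k = Suc j then A $$ (i, k) else 0)
           - (if k = 0 then A $$ (i, k) * coeff p (Suc j) else 0))"
    using assms by (subst index_mult_mat_sum[of _ n n])
      (auto simp: index_companion_mat
        simp del: sum.delta sum.delta' sum.lessThan_Suc intro!: sum.cong)
  then show ?thesis using assms by (simp add: sum_subtractf)
qed

text \<open>The half turn makes J the upward shift of rows and sends the coefficient row to the
  bottom in reverse order, with \<open>- coeff p (n - k)\<close> in column \<open>k\<close>. The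
  last row of the product is therefore a convolution sum.\<close>

lemma index_flip_companion_mult:
  assumes "A \<in> carrier_mat n n" "i < n" "j < n"
  shows "(flip_mat n * companion_mat n p * flip_mat n * A) $$ (i, j) =
           (if Suc i < n then A $$ (Suc i, j) else - (\<Sum>k<n. coeff p (n - k) * A $$ (k, j)))"
proof -
  have "(flip_mat n * companion_mat n p * flip_mat n * A) $$ (i, j) =
      (\<Sum>k<n. (if k = Suc i then A $$ (k, j) else 0)
           - (if Suc i = n then coeff p (n - k) * A $$ (k, j) else 0))"
    using assms
    by (subst index_mult_mat_sum[of _ n n])
      (auto simp: index_flip_mat_conj index_companion_mat Suc_diff_Suc
        simp del: sum.delta sum.delta' sum.lessThan_Suc intro!: sum.cong)
  then show ?thesis using assms by (auto simp: sum_subtractf sum_negf)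
qed

text \<open>Since PJP is the transpose of J, the left factor is the transpose of
  \<open>companion_mat n p\<close>, and the formula mirrors
  \<open>index_mult_companion_mat\<close>.\<close>

lemma index_flip_shift_mult:
  assumes "A \<in> carrier_mat n n" "i < n" "j < n"
  shows "((flip_mat n * shift_mat n * flip_mat n - outer_prod (coeff_vec n p) (first_unit n)) * A)
             $$ (i, j) =
           (if Suc i < n then A $$ (Suc i, j) else 0) - coeff p (Suc i) * A $$ (0, j)"
proof -
  let ?L = "flip_mat n * shift_mat n * flip_mat n - outer_prod (coeff_vec n p) (first_unit n)"
  have L: "?L \<in> carrier_mat n n"
    by (intro minus_carrier_mat outer_prod_carrier) simp_all
  have ent: "?L $$ (i, k) = (if k = Suc i then 1 else 0) - (if k = 0 then coeff p (Suc i) else 0)"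
    if "k < n" for k
    using assms that
    by (subst index_minus_mat(1))
      (auto simp: outer_prod_def index_first_unit index_coeff_vec index_flip_mat_conj shift_mat_def)
  have "(?L * A) $$ (i, j) = (\<Sum>k<n. (if k = Suc i then A $$ (k, j) else 0)
           - (if k = 0 then coeff p (Suc i) * A $$ (k, j) else 0))"
    using assms by (subst index_mult_mat_sum[OF L]) (auto simp: ent
      simp del: index_minus_mat(1) sum.delta sum.delta' sum.lessThan_Suc intro!: sum.cong)
  then show ?thesis using assms by (simp add: sum_subtractf)
qed

lemma index_mult_outer_first_unit:
  assumes "A \<in> carrier_mat n n" "dim_vec v = n" "i < n" "j < n"
  shows "(A * outer_prod (first_unit n) v) $$ (i, j) = A $$ (i, 0) * v $ j"
proof -
  have "(A * outer_prod (first_unit n) v) $$ (i, j) =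
      (\<Sum>k<n. if k = 0 then A $$ (i, k) * v $ j else 0)"
    using assms by (subst index_mult_mat_sum[of _ n n])
      (auto simp: outer_prod_def index_first_unit
        simp del: sum.delta sum.delta' sum.lessThan_Suc intro!: sum.cong)
  then show ?thesis using assms by simp
qed

lemma index_outer_first_unit_mult:
  assumes "A \<in> carrier_mat n n" "dim_vec v = n" "i < n" "j < n"
  shows "(outer_prod v (first_unit n) * A) $$ (i, j) = v $ i * A $$ (0, j)"
proof -
  have "(outer_prod v (first_unit n) * A) $$ (i, j) =
      (\<Sum>k<n. if k = 0 then v $ i * A $$ (k, j) else 0)"
    using assms by (subst index_mult_mat_sum[of _ n n])
      (auto simp: outer_prod_def index_first_unit
        simp del: sum.delta sum.delta' sum.lessThan_Suc intro!: sum.cong)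
  then show ?thesis using assms by simp
qed

section \<open>Intertwining of F and F_M by M(c, a)\<close>

lemma flip_shift_carrier:
  "flip_mat n * shift_mat n * flip_mat n - outer_prod (coeff_vec n p) (first_unit n)
     \<in> carrier_mat n n"
  by (intro minus_carrier_mat outer_prod_carrier) simp_all

lemma flip_conj_carrier:
  "A \<in> carrier_mat n n \<Longrightarrow> flip_mat n * A * flip_mat n \<in> carrier_mat n n"
  by (intro mult_carrier_mat) auto

text \<open>With \<open>p = a\<close> and \<open>q = c\<close> this is the lower left block of M F =
  F_M M; with \<open>p = q = c\<close> the outer product vanishes and the lower right block remains.
  The terms in \<open>q\<close> live in the last column and cancel there.\<close>

lemma hankel_hat_companion:
  assumes "coeff p 0 = 1" "coeff q 0 = 1"
  shows "flip_mat n * hankel_hat_mat n p * flip_mat n * companion_mat n p =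
      outer_prod (coeff_vec n q - coeff_vec n p) (first_unit n) * flip_mat n
      + (flip_mat n * shift_mat n * flip_mat n - outer_prod (coeff_vec n q) (first_unit n))
        * (flip_mat n * hankel_hat_mat n p * flip_mat n)" (is "?L = ?O + ?R")
proof -
  have T: "flip_mat n * hankel_hat_mat n p * flip_mat n \<in> carrier_mat n n"
    by (intro flip_conj_carrier) simp
  have car: "?L \<in> carrier_mat n n" "?O \<in> carrier_mat n n" "?R \<in> carrier_mat n n"
    using T by (auto intro!: mult_carrier_mat[of _ n n] outer_prod_carrier flip_shift_carrier)
  show ?thesis
  proof (rule eq_matI)
    fix i j assume "i < dim_row (?O + ?R)" "j < dim_col (?O + ?R)"
    then have ij: "i < n" "j < n" using car by auto
    have last: "Suc (Suc (i + j)) - n = Suc j" if "\<not> Suc i < n"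
      using ij that by linarith
    \<comment> \<open>The common value is symmetric in \<open>i\<close> and \<open>j\<close>: off
      the last row and column it is the shifted Hankel matrix, and on them everything cancels except
      in the corner.\<close>
    have "?L $$ (i, j) = (if Suc i < n \<and> Suc j < n \<and> n \<le> i + j + 2 then coeff p (i + j + 2 - n) else 0)
        - (if Suc i = n \<and> Suc j = n then coeff p n else 0)"
      using ij assms T by (auto simp: index_mult_companion_mat index_flip_hankel_hat last)
    also have "\<dots> = (?O + ?R) $$ (i, j)"
    proof -
      have "(?O + ?R) $$ (i, j) = ?O $$ (i, j) + ?R $$ (i, j)"
        using ij car by auto
      also have "?O $$ (i, j) = (if Suc j = n then coeff q (Suc i) - coeff p (Suc i) else 0)"
        using ij by (subst index_outer_first_unit_mult)
          (auto simp: index_coeff_vec flip_mat_def)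
      also have "?R $$ (i, j) = (if Suc i < n \<and> n \<le> i + j + 2 then coeff p (i + j + 2 - n) else 0)
          - (if Suc j = n then coeff q (Suc i) else 0)"
        using ij assms T by (auto simp: index_flip_shift_mult index_flip_hankel_hat)
      finally show ?thesis using ij by (cases "Suc i = n"; cases "Suc j = n") auto
    qed
    finally show "?L $$ (i, j) = (?O + ?R) $$ (i, j)" .
  qed (use car in auto)
qed

text \<open>The upper left block needs only P^2 = I; both lower blocks are instances of
  \<open>hankel_hat_companion\<close>.\<close>

lemma M_mat_F_mat:
  assumes a: "coeff a 0 = 1" and c: "coeff c 0 = 1"
  shows "M_mat n c a * F_mat n a c = FM_mat n a c * M_mat n c a"
proof -
  let ?P = "flip_mat n"
  let ?Ta = "?P * hankel_hat_mat n a * ?P"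
  let ?Tc = "?P * hankel_hat_mat n c * ?P"
  let ?K = "?P * companion_mat n a * ?P"
  let ?O = "outer_prod (coeff_vec n c - coeff_vec n a) (first_unit n)"
  let ?L = "?P * shift_mat n * ?P - outer_prod (coeff_vec n c) (first_unit n)"
  have T: "?Ta \<in> carrier_mat n n" "?Tc \<in> carrier_mat n n" "?K \<in> carrier_mat n n"
    by (auto intro!: flip_conj_carrier)
  have O: "?O \<in> carrier_mat n n" "?L \<in> carrier_mat n n"
    by (auto intro!: outer_prod_carrier flip_shift_carrier)
  have zero: "outer_prod (coeff_vec n c - coeff_vec n c) (first_unit n) * ?P = 0\<^sub>m n n"
    by (rule eq_matI)
      (auto simp: index_outer_first_unit_mult index_coeff_vec)
  have K: "?K * ?P = ?P * companion_mat n a"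
    by (simp add: assoc_mult_mat[of _ n n _ n _ n] flip_mat_square mult_carrier_mat[of _ n n]
        right_mult_one_mat[OF companion_mat_carrier])
  have "M_mat n c a * F_mat n a c = four_block_mat (?P * companion_mat n a) (0\<^sub>m n n)
      (?Ta * companion_mat n a) (?Tc * companion_mat n c)"
    unfolding M_mat_def F_mat_def using T
    by (subst mult_four_block_mat[of _ n n _ n _ n _ _ n _ n]) auto
  also have "?Ta * companion_mat n a = ?O * ?P + ?L * ?Ta"
    by (rule hankel_hat_companion[OF a c])
  also have "?Tc * companion_mat n c = ?L * ?Tc"
    using hankel_hat_companion[OF c c, of n] T O by (simp add: zero mult_carrier_mat[of _ n n])
  also have "four_block_mat (?P * companion_mat n a) (0\<^sub>m n n) (?O * ?P + ?L * ?Ta) (?L * ?Tc)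
      = FM_mat n a c * M_mat n c a"
    unfolding M_mat_def FM_mat_def using T O K
    by (subst mult_four_block_mat[of _ n n _ n _ n _ _ n _ n])
      (auto simp: mult_carrier_mat[of _ n n])
  finally show ?thesis .
qed

section \<open>Intertwining of G and G_N by N(c)\<close>

text \<open>For \<open>k = m = n\<close> and \<open>p = a * c\<close> this is the second half of the
  vector g.\<close>

definition coeff_vec_from :: "nat \<Rightarrow> nat \<Rightarrow> real poly \<Rightarrow> real vec" where
  "coeff_vec_from k m p = vec m (\<lambda>i. coeff p (k + i + 1))"

text \<open>Cuts G into blocks that match those of N(c). The lower left block holds the one
  subdiagonal entry of J that crosses the block boundary.\<close>

lemma companion_mat_double:
  "companion_mat (n + n) p =
     four_block_mat (companion_mat n p) (- outer_prod (first_unit n) (coeff_vec_from n n p))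
       (mat n n (\<lambda>(i, j). if i = 0 \<and> Suc j = n then 1 else 0)) (shift_mat n)"
    (is "_ = four_block_mat ?A ?B ?C ?D")
proof -
  have B: "outer_prod (first_unit n) (coeff_vec_from n n p) \<in> carrier_mat n n"
    by (simp add: outer_prod_carrier coeff_vec_from_def)
  have d: "dim_row ?A = n" "dim_col ?A = n" "dim_row ?D = n" "dim_col ?D = n"
    using companion_mat_carrier[of n p] shift_mat_carrier[of n] by auto
  show ?thesis
  proof (rule eq_matI)
    fix i j assume "i < dim_row (four_block_mat ?A ?B ?C ?D)"
      "j < dim_col (four_block_mat ?A ?B ?C ?D)"
    then have ij: "i < n + n" "j < n + n" using d by auto
    have B': "(- outer_prod (first_unit n) (coeff_vec_from n n p)) $$ (i, j - n) =
        (if i = 0 then - coeff p (Suc j) else 0)" if "i < n" "\<not> j < n"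
      using ij that B by (auto simp: index_outer_prod coeff_vec_from_def index_first_unit)
    show "companion_mat (n + n) p $$ (i, j) = four_block_mat ?A ?B ?C ?D $$ (i, j)"
      using ij B' by (subst index_mat_four_block(1))
        (auto simp: d index_companion_mat shift_mat_def)
  qed (use d companion_mat_carrier[of "n + n" p] in auto)
qed

text \<open>The sum is the one that \<open>index_flip_companion_mult\<close> yields, up to sign, in
  the last row when \<open>A\<close> is the half turn of \<open>hankel_hat_mat n q\<close>. The
  constant term of \<open>p\<close> is split off because the coefficient row omits it.\<close>

lemma coeff_mult_low:
  fixes p q :: "real poly"
  assumes "coeff q 0 = 1" "degree p \<le> n" "j < n"
  shows "coeff (p * q) (Suc j) = coeff q (Suc j) * coeff p 0
    + (\<Sum>k<n. coeff p (n - k) * (if n \<le> Suc (k + j) then coeff q (Suc (k + j) - n) else 0))"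
proof -
  have "coeff (p * q) (Suc j) = (\<Sum>i\<le>Suc j. coeff p i * coeff q (Suc j - i))"
    by (simp add: coeff_mult)
  also have "\<dots> = coeff p 0 * coeff q (Suc j) + (\<Sum>i\<le>j. coeff p (Suc i) * coeff q (j - i))"
    by (subst sum.atMost_Suc_shift) simp
  \<comment> \<open>The new index is \<open>k = n - 1 - i\<close>, so that
    \<open>Suc i = n - k\<close> fits the reversed coefficient row.\<close>
  also have "(\<Sum>i\<le>j. coeff p (Suc i) * coeff q (j - i)) =
      (\<Sum>k\<in>{n - 1 - j..<n}. coeff p (n - k) * coeff q (Suc (k + j) - n))"
    using assms(3)
    by (intro sum.reindex_bij_witness[of _ "\<lambda>k. n - 1 - k" "\<lambda>i. n - 1 - i"])
      (auto intro!: arg_cong2[of _ _ _ _ "(*)"] arg_cong[of _ _ "coeff _"])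
  also have "\<dots> = (\<Sum>k<n. coeff p (n - k) * (if n \<le> Suc (k + j) then coeff q (Suc (k + j) - n) else 0))"
    by (intro sum.mono_neutral_cong_left) auto
  finally show ?thesis by simp
qed

text \<open>Counterpart of \<open>coeff_mult_low\<close> for the second half of g, with
  \<open>hankel_mat n q\<close> in the role of \<open>A\<close>.\<close>

lemma coeff_mult_high:
  fixes p q :: "real poly"
  assumes "degree p \<le> n" "degree q \<le> n"
  shows "coeff (p * q) (Suc (n + j)) =
    (\<Sum>k<n. coeff p (n - k) * (if k + j < n then coeff q (Suc (k + j)) else 0))"
proof -
  have "coeff (p * q) (Suc (n + j)) = (\<Sum>i\<le>Suc (n + j). coeff p i * coeff q (Suc (n + j) - i))"
    by (simp add: coeff_mult)
  \<comment> \<open>The term \<open>i = 0\<close> drops out by the degree of \<open>q\<close>, the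
    terms \<open>i > n\<close> by the degree of \<open>p\<close>.\<close>
  also have "\<dots> = (\<Sum>i\<in>{1..n}. coeff p i * coeff q (Suc (n + j) - i))"
    using assms by (intro sum.mono_neutral_right) (auto simp: coeff_eq_0 not_le)
  also have "\<dots> = (\<Sum>k<n. coeff p (n - k) * coeff q (Suc (k + j)))"
    by (rule sum.reindex_bij_witness[of _ "\<lambda>k. n - k" "\<lambda>i. n - i"])
      (auto intro!: arg_cong[of _ _ "coeff _"])
  also have "\<dots> = (\<Sum>k<n. coeff p (n - k) * (if k + j < n then coeff q (Suc (k + j)) else 0))"
    using assms by (intro sum.cong) (auto simp: coeff_eq_0)
  finally show ?thesis .
qed

text \<open>The facts \<open>11\<close>, \<open>12\<close>, \<open>21\<close>, \<open>22\<close> are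
  named after block positions. In \<open>11\<close> and \<open>12\<close> all rows but the last are
  shifts; the last rows are \<open>coeff_mult_low\<close> and
  \<open>coeff_mult_high\<close>.\<close>

lemma N_mat_G_mat:
  assumes dega: "degree a \<le> n" and a: "coeff a 0 = 1"
    and degc: "degree c \<le> n" and c: "coeff c 0 = 1"
  shows "N_mat n c * G_mat n a c = GN_mat n a c * N_mat n c"
proof -
  let ?P = "flip_mat n"
  let ?T = "?P * hankel_hat_mat n c * ?P"
  let ?S = "hankel_mat n c"
  let ?K = "?P * companion_mat n a * ?P"
  let ?v = "coeff_vec_from n n (a * c)"
  let ?E = "mat n n (\<lambda>(i, j). if i = 0 \<and> Suc j = n then 1 else 0) :: real mat"
  let ?U = "outer_prod (first_unit n) (first_unit n)"
  let ?V = "- outer_prod (first_unit n) ?v"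
  have T: "?T \<in> carrier_mat n n" "?K \<in> carrier_mat n n" "?U \<in> carrier_mat n n"
    by (auto intro!: flip_conj_carrier outer_prod_carrier)
  have v: "dim_vec ?v = n" by (simp add: coeff_vec_from_def)
  have V: "outer_prod (first_unit n) ?v \<in> carrier_mat n n"
    using v by (intro outer_prod_carrier) auto
  have carr [simp]: "A * B \<in> carrier_mat n n"
    if "A \<in> carrier_mat n n" "B \<in> carrier_mat n n" for A B :: "real mat"
    using that by (rule mult_carrier_mat)
  \<comment> \<open>The single corner entry of \<open>?E\<close> carries the first column of
    \<open>?S\<close>, the vector c, into the last column. That is the column left empty when
    \<open>?T\<close> is shifted in \<open>11\<close>.\<close>
  have SE: "(?S * ?E) $$ (i, j) = (if Suc j = n then coeff c (Suc i) else 0)"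
    if "i < n" "j < n" for i j
  proof -
    have "(?S * ?E) $$ (i, j) = (\<Sum>k<n. if k = 0 then (if Suc j = n then ?S $$ (i, k) else 0) else 0)"
      using that by (subst index_mult_mat_sum[of _ n n]) (auto
        simp del: sum.delta sum.delta' sum.lessThan_Suc intro!: sum.cong)
    then show ?thesis using that by (simp add: hankel_mat_def)
  qed
  have SJ: "(?S * shift_mat n) $$ (i, j) = (if Suc (i + j) < n then coeff c (Suc (Suc (i + j))) else 0)"
    if "i < n" "j < n" for i j
  proof -
    have "(?S * shift_mat n) $$ (i, j) = (\<Sum>k<n. if k = Suc j then ?S $$ (i, k) else 0)"
      using that by (subst index_mult_mat_sum[of _ n n]) (auto simp: shift_mat_def
        simp del: sum.delta sum.delta' sum.lessThan_Suc intro!: sum.cong)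
    then show ?thesis using that by (auto simp: hankel_mat_def)
  qed
  have 11: "?T * companion_mat n (a * c) + ?S * ?E = ?K * ?T"
  proof (rule eq_matI)
    fix i j assume "i < dim_row (?K * ?T)" "j < dim_col (?K * ?T)"
    then have ij: "i < n" "j < n" using T by auto
    have "(?T * companion_mat n (a * c) + ?S * ?E) $$ (i, j) =
        (?T * companion_mat n (a * c)) $$ (i, j) + (?S * ?E) $$ (i, j)"
      using ij T by (subst index_add_mat(1)) auto
    \<comment> \<open>The first column of \<open>?T\<close> is the last unit vector, so the
      coefficients of \<open>a * c\<close> enter only in the last row.\<close>
    also have "\<dots> = (if Suc i < n then (if n \<le> i + j + 2 then coeff c (i + j + 2 - n) else 0)
        else coeff c (Suc j) - coeff (a * c) (Suc j))"
      using ij c T by (auto simp: SE index_mult_companion_mat index_flip_hankel_hat less_Suc_eq_le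
          not_less intro!: arg_cong[of _ _ "coeff c"])
    also have "\<dots> = (?K * ?T) $$ (i, j)"
      using ij T coeff_mult_low[OF c dega ij(2)] a
      by (auto simp: index_flip_companion_mult index_flip_hankel_hat)
    finally show "(?T * companion_mat n (a * c) + ?S * ?E) $$ (i, j) = (?K * ?T) $$ (i, j)" .
  qed (use T in auto)
  have 12: "?T * ?V + ?S * shift_mat n = ?K * ?S"
  proof (rule eq_matI)
    fix i j assume "i < dim_row (?K * ?S)" "j < dim_col (?K * ?S)"
    then have ij: "i < n" "j < n" using T by (auto simp: hankel_mat_def)
    have TV: "(?T * ?V) $$ (i, j) = - (?T $$ (i, 0) * ?v $ j)"
    proof -
      have "?T * ?V = - (?T * outer_prod (first_unit n) ?v)"
        using T V by (intro uminus_mult_right_mat) auto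
      then show ?thesis
        using ij T V v carr[OF T(1) V] by (simp add: index_mult_outer_first_unit)
    qed
    have "(?T * ?V + ?S * shift_mat n) $$ (i, j) = (?T * ?V) $$ (i, j) + (?S * shift_mat n) $$ (i, j)"
      using ij T V by (subst index_add_mat(1)) (auto simp: shift_mat_def hankel_mat_def)
    also have "\<dots> = (if Suc i < n then (if Suc (i + j) < n then coeff c (Suc (Suc (i + j))) else 0)
        else - coeff (a * c) (Suc (n + j)))"
      using ij c unfolding TV by (auto simp: SJ index_flip_hankel_hat coeff_vec_from_def)
    also have "\<dots> = (?K * ?S) $$ (i, j)"
      using ij coeff_mult_high[OF dega degc, of j]
      by (auto simp: index_flip_companion_mult index_hankel_mat)
    finally show "(?T * ?V + ?S * shift_mat n) $$ (i, j) = (?K * ?S) $$ (i, j)" .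
  qed (use T V in \<open>auto simp: shift_mat_def hankel_mat_def\<close>)
  have zero: "- 0\<^sub>m n n = (0\<^sub>m n n :: real mat)"
    by (rule eq_matI) auto
  \<comment> \<open>\<open>?U\<close> keeps only the first row, and that of \<open>?T\<close> is the
    last unit vector.\<close>
  have 21: "?E = ?U * ?T"
    using T c by (intro eq_matI) (auto simp: index_outer_first_unit_mult index_flip_hankel_hat
        index_first_unit)
  \<comment> \<open>The first row of \<open>?S\<close> is the coefficient vector of
    \<open>c\<close>, so \<open>?U * ?S\<close> restores what the companion matrix
    subtracts.\<close>
  have 22: "shift_mat n = ?U * ?S + companion_mat n c"
  proof (rule eq_matI)
    fix i j assume "i < dim_row (?U * ?S + companion_mat n c)"
      "j < dim_col (?U * ?S + companion_mat n c)"
    then have ij: "i < n" "j < n" using companion_mat_carrier[of n c] by auto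
    then have "(?U * ?S) $$ (i, j) = (if i = 0 then coeff c (Suc j) else 0)"
      by (subst index_outer_first_unit_mult) (auto simp: index_first_unit hankel_mat_def)
    then show "shift_mat n $$ (i, j) = (?U * ?S + companion_mat n c) $$ (i, j)"
      using ij companion_mat_carrier[of n c]
      by (subst index_add_mat(1)) (auto simp: index_companion_mat shift_mat_def)
  qed (use companion_mat_carrier[of n c] in \<open>auto simp: shift_mat_def\<close>)
  have "N_mat n c * G_mat n a c = four_block_mat (?T * companion_mat n (a * c) + ?S * ?E)
      (?T * ?V + ?S * shift_mat n) ?E (shift_mat n)"
    unfolding N_mat_def G_mat_def mult_2 companion_mat_double using T V
    by (subst mult_four_block_mat[of _ n n _ n _ n _ _ n _ n]) (auto simp: v zero)
  also have "\<dots> = four_block_mat (?K * ?T) (?K * ?S) (?U * ?T) (?U * ?S + companion_mat n c)"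
    by (simp only: 11 12 flip: 21 22)
  also have "\<dots> = GN_mat n a c * N_mat n c"
    unfolding N_mat_def GN_mat_def using T
    by (subst mult_four_block_mat[of _ n n _ n _ n _ _ n _ n]) auto
  finally show ?thesis .
qed

section \<open>The Bezout matrix intertwines F_M and G_N\<close>

text \<open>The one-variable statement is applied in \<open>z\<close> for each fixed
  \<open>w\<close>, and then in \<open>w\<close>.\<close>

lemma bivariate_sum_zero_coeffs:
  fixes f :: "nat \<Rightarrow> nat \<Rightarrow> real"
  assumes "\<And>z w. (\<Sum>i<m. \<Sum>j<n. f i j * (z ^ i * w ^ j)) = 0" and "i < m" "j < n"
  shows "f i j = 0"
proof -
  have "(\<Sum>j<n. f i j * w ^ j) = 0" for w
  proof (rule power_sum_zero_coeffs[OF _ \<open>i < m\<close>])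
    have "(\<Sum>i<m. (\<Sum>j<n. f i j * w ^ j) * z ^ i) = 0" for z
      using assms(1)[of z w] by (simp add: sum_distrib_left sum_distrib_right mult_ac)
    then show "infinite {z. (\<Sum>i<m. (\<Sum>j<n. f i j * w ^ j) * z ^ i) = 0}"
      by (simp add: infinite_UNIV_char_0)
  qed
  then show ?thesis
    by (intro power_sum_zero_coeffs[OF _ \<open>j < n\<close>]) (simp add: infinite_UNIV_char_0)
qed

text \<open>The truncated subtractions \<open>i - 1\<close> and \<open>j - 1\<close> are guarded by the conditionals, and the
  entries of \<open>B\<close> with an index out of range count as zero.\<close>

lemma bezout_mat_coeffs:
  assumes B: "is_bezout_mat n c a B" and dega: "degree a \<le> n" and degc: "degree c \<le> n"
    and ij: "i \<le> n" "j \<le> n"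
  shows "coeff c i * coeff a j - coeff c j * coeff a i =
     (if 0 < i \<and> j < n then B $$ (i - 1, j) else 0) - (if 0 < j \<and> i < n then B $$ (i, j - 1) else 0)"
proof -
  \<comment> \<open>\<open>L\<close> and \<open>R\<close> are the coefficients of
    \<open>z ^ i * w ^ j\<close> in \<open>z\<close> times and \<open>w\<close> times the Bezout
    form; \<open>f\<close> is the coefficient of the difference of both sides of the defining
    equation.\<close>
  define L where "L i j = (if 0 < i \<and> j < n then B $$ (i - 1, j) else 0)" for i j
  define R where "R i j = (if 0 < j \<and> i < n then B $$ (i, j - 1) else 0)" for i j
  define f where "f i j = coeff c i * coeff a j - coeff c j * coeff a i - L i j + R i j" for i j
  have B': "B \<in> carrier_mat n n" using B by (simp add: is_bezout_mat_def)
  have p: "poly p z = (\<Sum>i<Suc n. coeff p i * z ^ i)" if "degree p \<le> n" for p :: "real poly" and z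
    using that unfolding lessThan_Suc_atMost
    by (subst poly_altdef) (rule sum.mono_neutral_left, auto simp: coeff_eq_0)
  have "(\<Sum>i<Suc n. \<Sum>j<Suc n. f i j * (z ^ i * w ^ j)) = 0" for z w
  proof -
    have "(\<Sum>i<Suc n. \<Sum>j<Suc n. f i j * (z ^ i * w ^ j)) =
        (\<Sum>i<Suc n. \<Sum>j<Suc n. (coeff c i * z ^ i) * (coeff a j * w ^ j))
        - (\<Sum>i<Suc n. \<Sum>j<Suc n. (coeff a i * z ^ i) * (coeff c j * w ^ j))
        - (\<Sum>i<Suc n. \<Sum>j<Suc n. L i j * (z ^ i * w ^ j))
        + (\<Sum>i<Suc n. \<Sum>j<Suc n. R i j * (z ^ i * w ^ j))"
      unfolding sum_subtractf[symmetric] sum.distrib[symmetric]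
      by (intro sum.cong refl) (simp add: f_def algebra_simps)
    also have "(\<Sum>i<Suc n. \<Sum>j<Suc n. (coeff c i * z ^ i) * (coeff a j * w ^ j)) = poly c z * poly a w"
      by (simp only: p[OF dega] p[OF degc] sum_product)
    also have "(\<Sum>i<Suc n. \<Sum>j<Suc n. (coeff a i * z ^ i) * (coeff c j * w ^ j)) = poly a z * poly c w"
      by (simp only: p[OF dega] p[OF degc] sum_product)
    also have "(\<Sum>i<Suc n. \<Sum>j<Suc n. L i j * (z ^ i * w ^ j)) =
        z * (\<Sum>i<n. \<Sum>j<n. B $$ (i, j) * z ^ i * w ^ j)"
      by (subst sum.lessThan_Suc_shift) (simp add: L_def sum_distrib_left mult_ac)
    also have "(\<Sum>i<Suc n. \<Sum>j<Suc n. R i j * (z ^ i * w ^ j)) =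
        w * (\<Sum>i<n. \<Sum>j<n. B $$ (i, j) * z ^ i * w ^ j)"
      by (simp only: sum.lessThan_Suc_shift[of "\<lambda>j. R _ j * _ j"] sum.lessThan_Suc[of _ n])
        (simp add: R_def sum_distrib_left mult_ac)
    also have "(\<Sum>i<n. \<Sum>j<n. B $$ (i, j) * z ^ i * w ^ j) = power_vec n z \<bullet> (B *\<^sub>v power_vec n w)"
      by (rule bezout_form[OF B', symmetric])
    also have "poly c z * poly a w - poly a z * poly c w
        - z * (power_vec n z \<bullet> (B *\<^sub>v power_vec n w))
        + w * (power_vec n z \<bullet> (B *\<^sub>v power_vec n w)) = 0"
    proof -
      have "poly c z * poly a w - poly c w * poly a z
          = (z - w) * (power_vec n z \<bullet> (B *\<^sub>v power_vec n w))"
        using B by (simp add: is_bezout_mat_def)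
      then show ?thesis by (simp add: algebra_simps)
    qed
    finally show ?thesis .
  qed
  then have "f i j = 0"
    by (rule bivariate_sum_zero_coeffs[where m = "Suc n" and n = "Suc n"])
      (simp_all add: ij less_Suc_eq_le del: sum.lessThan_Suc)
  then show ?thesis by (simp add: f_def L_def R_def)
qed

text \<open>Only the lower blocks carry content: \<open>21\<close> says that the first column of
  \<open>B\<close> is c - a, and \<open>22\<close> that \<open>B\<close> intertwines the companion
  matrix of \<open>c\<close> with its transpose.\<close>

lemma FM_mat_bezout_GN_mat:
  assumes dega: "degree a \<le> n" and a: "coeff a 0 = 1"
    and degc: "degree c \<le> n" and c: "coeff c 0 = 1"
    and bez: "is_bezout_mat n c a B"
  shows "FM_mat n a c * four_block_mat (1\<^sub>m n) (0\<^sub>m n n) (0\<^sub>m n n) B =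
    four_block_mat (1\<^sub>m n) (0\<^sub>m n n) (0\<^sub>m n n) B * GN_mat n a c"
proof -
  let ?P = "flip_mat n"
  let ?K = "?P * companion_mat n a * ?P"
  let ?O = "outer_prod (coeff_vec n c - coeff_vec n a) (first_unit n)"
  let ?L = "?P * shift_mat n * ?P - outer_prod (coeff_vec n c) (first_unit n)"
  let ?U = "outer_prod (first_unit n) (first_unit n)"
  note q = bezout_mat_coeffs[OF bez dega degc]
  have B: "B \<in> carrier_mat n n" using bez by (simp add: is_bezout_mat_def)
  have K: "?K \<in> carrier_mat n n" "?O \<in> carrier_mat n n" "?L \<in> carrier_mat n n" "?U \<in> carrier_mat n n"
    by (auto intro!: flip_conj_carrier outer_prod_carrier flip_shift_carrier)
  have col: "B $$ (i, 0) = coeff c (Suc i) - coeff a (Suc i)" if "i < n" for i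
    using q[of "Suc i" 0] that a c by simp
  have row: "B $$ (0, j) = coeff c (Suc j) - coeff a (Suc j)" if "j < n" for j
    using q[of 0 "Suc j"] that a c by simp
  have 21: "?O = B * ?U"
    using B by (intro eq_matI) (auto simp: index_mult_outer_first_unit index_outer_prod index_coeff_vec
        index_first_unit col)
  have 22: "?L * B = B * companion_mat n c"
  proof (rule eq_matI)
    fix i j assume "i < dim_row (B * companion_mat n c)" "j < dim_col (B * companion_mat n c)"
    then have ij: "i < n" "j < n" using B companion_mat_carrier[of n c] by auto
    have "(?L * B) $$ (i, j) = (if Suc i < n then B $$ (Suc i, j) else 0) - coeff c (Suc i) * B $$ (0, j)"
      using B ij by (rule index_flip_shift_mult)
    \<comment> \<open>After \<open>row\<close> and \<open>col\<close> are inserted, the products of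
      two coefficients of \<open>c\<close> cancel, and the coefficient relation at
      \<open>(Suc i, Suc j)\<close> remains.\<close>
    also have "\<dots> = (if Suc j < n then B $$ (i, Suc j) else 0) - B $$ (i, 0) * coeff c (Suc j)"
      using q[of "Suc i" "Suc j"] ij by (auto simp: row col algebra_simps split: if_splits)
    also have "\<dots> = (B * companion_mat n c) $$ (i, j)"
      using B ij by (rule index_mult_companion_mat[symmetric])
    finally show "(?L * B) $$ (i, j) = (B * companion_mat n c) $$ (i, j)" .
  qed (use B K companion_mat_carrier[of n c] in auto)
  have "FM_mat n a c * four_block_mat (1\<^sub>m n) (0\<^sub>m n n) (0\<^sub>m n n) B =
      four_block_mat ?K (0\<^sub>m n n) ?O (?L * B)"
    unfolding FM_mat_def using B K
    by (subst mult_four_block_mat[of _ n n _ n _ n _ _ n _ n]) (auto simp: mult_carrier_mat[of _ n n])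
  also have "\<dots> = four_block_mat ?K (0\<^sub>m n n) (B * ?U) (B * companion_mat n c)"
    by (simp only: 22 flip: 21)
  also have "\<dots> = four_block_mat (1\<^sub>m n) (0\<^sub>m n n) (0\<^sub>m n n) B * GN_mat n a c"
    unfolding GN_mat_def using B K
    by (subst mult_four_block_mat[of _ n n _ n _ n _ _ n _ n]) (auto simp: mult_carrier_mat[of _ n n])
  finally show ?thesis .
qed

section \<open>From the intertwining relations to the similarities\<close>

lemma conj_eq_of_intertwine:
  fixes A F G :: "real mat"
  assumes "A \<in> carrier_mat m m" "G \<in> carrier_mat m m" "B \<in> carrier_mat m m"
    and "A * F = G * A" "A * B = 1\<^sub>m m"
  shows "A * F * B = G"
  using assms by (simp add: assoc_mult_mat[of _ m m _ m _ m])

lemma FM_mat_carrier: "FM_mat n a c \<in> carrier_mat (2 * n) (2 * n)"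
  unfolding FM_mat_def mult_2
  by (intro four_block_carrier_mat flip_conj_carrier flip_shift_carrier companion_mat_carrier)

lemma GN_mat_carrier: "GN_mat n a c \<in> carrier_mat (2 * n) (2 * n)"
  unfolding GN_mat_def mult_2
  by (intro four_block_carrier_mat flip_conj_carrier companion_mat_carrier)

theorem theorem4p2:
  fixes n :: nat and a c :: "real poly"
  assumes "n \<ge> 1"
    and "degree a \<le> n" and "coeff a 0 = 1"
    and "degree c \<le> n" and "coeff c 0 = 1"
  shows "M_mat n c a * F_mat n a c * the (mat_inverse (M_mat n c a)) = FM_mat n a c
    \<and> N_mat n c * G_mat n a c * the (mat_inverse (N_mat n c)) = GN_mat n a c
    \<and> FM_mat n a c
        * four_block_mat (1\<^sub>m n) (0\<^sub>m n n) (0\<^sub>m n n) (bezout_mat n c a)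
      = four_block_mat (1\<^sub>m n) (0\<^sub>m n n) (0\<^sub>m n n) (bezout_mat n c a)
        * GN_mat n a c"
proof (intro conjI)
  show "M_mat n c a * F_mat n a c * the (mat_inverse (M_mat n c a)) = FM_mat n a c"
    using M_mat_inverse[OF assms(5), of n a]
      conj_eq_of_intertwine[OF M_mat_carrier FM_mat_carrier _ M_mat_F_mat[OF assms(3,5)]]
    by auto
  show "N_mat n c * G_mat n a c * the (mat_inverse (N_mat n c)) = GN_mat n a c"
    using N_mat_inverse[OF assms(5), of n]
      conj_eq_of_intertwine[OF N_mat_carrier GN_mat_carrier _ N_mat_G_mat[OF assms(2-5)]]
    by auto
  show "FM_mat n a c * four_block_mat (1\<^sub>m n) (0\<^sub>m n n) (0\<^sub>m n n) (bezout_mat n c a)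
      = four_block_mat (1\<^sub>m n) (0\<^sub>m n n) (0\<^sub>m n n) (bezout_mat n c a) * GN_mat n a c"
    by (rule FM_mat_bezout_GN_mat[OF assms(2-5) is_bezout_mat_bezout_mat[OF assms(2,4)]])
qed

end
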